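(* Let $M$ be a totally ordered (commutative) monoid with the cancellation property, written additively, and let $R=\bigoplus_{m\in M}R_m$ be an $M$-graded commutative ring. If $R$ has a homogeneous element of nonzero degree which is a non-zero-divisor of $R$, then $R$ is quasi-Jacobson, i.e. the nilradical and the Jacobson radical of $R$ are equal.
   Context: Rings have an identity. An $M$-graded ring is a ring $R$ with a decomposition $R=\bigoplus_{m\in M}R_m$ of its additive group into subgroups with $R_mR_n\subseteq R_{m+n}$ for all $m,n\in M$. A homogeneous element of degree $m$ is a nonzero element of $R_m$; nonzero degree means $m$ is not the identity $0$ of $M$. A totally ordered monoid is a commutative monoid with a total order $<$ such that $a<b$ implies $a+x\leqslant b+x$ for all $x$; the cancellation property means $a+x=b+x$ implies $a=b$. *)

theory Defs
  imports "HOL-Algebra.Ideal"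
begin

text \<open>
  The indexing monoid is a type. Since an element of the direct sum has only finitely many
  nonzero components, the decomposition \<open>R = \<Oplus>\<^sub>m A m\<close> is stated as existence and uniqueness of
  a finitely supported family of components adding up to a given element.
\<close>

locale graded_ring = ring R for R (structure) +
  fixes A :: "'m::comm_monoid_add \<Rightarrow> 'a set"
  assumes component_subgroup: "additive_subgroup (A m) R"
    and component_mult: "\<lbrakk>a \<in> A m; b \<in> A n\<rbrakk> \<Longrightarrow> a \<otimes> b \<in> A (m + n)"
    and direct_sum: "x \<in> carrier R \<Longrightarrow>
      \<exists>!f. (\<forall>m. f m \<in> A m) \<and> finite {m. f m \<noteq> \<zero>} \<and> x = (\<Oplus>m\<in>{m. f m \<noteq> \<zero>}. f m)"

definition homogeneous_of_degree :: "('a, 'b) ring_scheme \<Rightarrow> ('m \<Rightarrow> 'a set) \<Rightarrow> 'm \<Rightarrow> 'a \<Rightarrow> bool"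
  where "homogeneous_of_degree R A m x \<longleftrightarrow> x \<in> A m \<and> x \<noteq> \<zero>\<^bsub>R\<^esub>"

text \<open>For commutative rings only: one-sided multiplication suffices.\<close>

definition non_zero_divisor :: "('a, 'b) ring_scheme \<Rightarrow> 'a \<Rightarrow> bool"
  where "non_zero_divisor R x \<longleftrightarrow>
    x \<in> carrier R \<and> (\<forall>y\<in>carrier R. x \<otimes>\<^bsub>R\<^esub> y = \<zero>\<^bsub>R\<^esub> \<longrightarrow> y = \<zero>\<^bsub>R\<^esub>)"

definition nilradical :: "('a, 'b) ring_scheme \<Rightarrow> 'a set"
  where "nilradical R = {x \<in> carrier R. \<exists>n::nat. x [^]\<^bsub>R\<^esub> n = \<zero>\<^bsub>R\<^esub>}"

text \<open>Intersecting with the carrier matters only for the zero ring, which has no maximal ideals.\<close>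

definition jacobson_radical :: "('a, 'b) ring_scheme \<Rightarrow> 'a set"
  where "jacobson_radical R = carrier R \<inter> \<Inter> {J. maximalideal J R}"

definition quasi_jacobson :: "('a, 'b) ring_scheme \<Rightarrow> bool"
  where "quasi_jacobson R \<longleftrightarrow> nilradical R = jacobson_radical R"

end

theory Submission
  imports Defs "HOL-Algebra.Ring_Divisibility"
begin

text \<open>
  Let \<open>t\<close> be a homogeneous non-zero-divisor of nonzero degree \<open>d\<close> and let \<open>x\<close> lie in the Jacobson
  radical. The multiples of \<open>d\<close> are pairwise distinct, so for some \<open>k\<close> the element \<open>y = x t\<^sup>k\<close> has no
  component of degree \<open>0\<close>, while \<open>1 + y\<close> is a unit. Comparing the extreme degrees of a unit and of
  its inverse modulo a prime ideal \<open>P\<close> shows that all components of \<open>1 + y\<close> outside degree \<open>0\<close> lie in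
  \<open>P\<close>. Hence \<open>y\<close> lies in every prime ideal and is nilpotent, and cancelling the power of \<open>t\<close> shows
  that \<open>x\<close> is nilpotent.
\<close>

section \<open>Prime and maximal ideals in commutative rings\<close>

lemma (in additive_subgroup) finsum_mem:
  assumes "abelian_group G" "finite I" "\<And>i. i \<in> I \<Longrightarrow> f i \<in> H"
  shows "(\<Oplus>i\<in>I. f i) \<in> H"
proof -
  interpret abelian_group G by fact
  show ?thesis
    using assms(2,3)
    by (induction I rule: finite_induct) (auto simp: a_Hcarr)
qed

text \<open>Zorn's lemma on the ideals that contain \<open>I\<close> and miss \<open>S\<close>. The
  set \<open>S\<close> stays arbitrary because two choices are needed: \<open>{\<one>}\<close>
  produces maximal ideals, the powers of an element produce prime ideals.\<close>

lemma (in ring) exists_ideal_maximal_avoiding: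
  assumes "ideal I R" "I \<inter> S = {}"
  obtains P where "ideal P R" "I \<subseteq> P" "P \<inter> S = {}"
    "\<forall>J. ideal J R \<and> P \<subseteq> J \<and> J \<inter> S = {} \<longrightarrow> J = P"
proof -
  let ?F = "{J. ideal J R \<and> I \<subseteq> J \<and> J \<inter> S = {}}"
  have "\<exists>P\<in>?F. \<forall>J\<in>?F. P \<subseteq> J \<longrightarrow> J = P"
  proof (rule subset_Zorn_nonempty)
    show "?F \<noteq> {}" using assms by blast
  next
    fix C assume C: "C \<noteq> {}" "subset.chain ?F C"
    then have "subset.chain {J. ideal J R} C"
      by (auto simp: subset_chain_def)
    from chain_Union_is_ideal[OF this] C have "ideal (\<Union>C) R" by simp
    with C show "\<Union>C \<in> ?F" by (fastforce simp: subset_chain_def)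
  qed
  then obtain P where "P \<in> ?F" "\<forall>J\<in>?F. P \<subseteq> J \<longrightarrow> J = P" by blast
  then show thesis by (intro that[of P]) auto
qed

lemma (in cring) proper_ideal_in_maximalideal:
  assumes "ideal I R" "\<one> \<notin> I"
  shows "\<exists>P. maximalideal P R \<and> I \<subseteq> P"
proof -
  obtain P where P: "ideal P R" "I \<subseteq> P" "P \<inter> {\<one>} = {}"
    and max: "\<forall>J. ideal J R \<and> P \<subseteq> J \<and> J \<inter> {\<one>} = {} \<longrightarrow> J = P"
    using exists_ideal_maximal_avoiding[of I "{\<one>}"] assms by auto
  have "maximalideal P R"
    by (rule maximalidealI) (use P max ideal.one_imp_carrier in blast)+
  with P show ?thesis by blast
qed

text \<open>Krull's argument: an ideal maximal among those missing all powers of \<open>y\<close> is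
  prime. This is how membership in every prime ideal is turned into nilpotency.\<close>

lemma (in cring) exists_primeideal_avoiding:
  assumes y: "y \<in> carrier R" and not_nil: "\<And>n::nat. y [^] n \<noteq> \<zero>"
  shows "\<exists>P. primeideal P R \<and> y \<notin> P"
proof -
  let ?S = "range (\<lambda>n::nat. y [^] n)"
  have "{\<zero>} \<inter> ?S = {}" using not_nil by force
  then obtain P where P: "ideal P R" "{\<zero>} \<subseteq> P" "P \<inter> ?S = {}"
    and max: "\<forall>J. ideal J R \<and> P \<subseteq> J \<and> J \<inter> ?S = {} \<longrightarrow> J = P"
    by (rule exists_ideal_maximal_avoiding[OF zeroideal])
  interpret P: ideal P R by fact
  have notin: "y [^] n \<notin> P" for n :: nat using P(3) by blast
  have y_notin: "y \<notin> P" using notin[of 1] y by simp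
  \<comment> \<open>By maximality, enlarging \<open>P\<close> by an outside element \<open>a\<close>
    makes the ideal meet the powers of \<open>y\<close>.\<close>
  have meets: "\<exists>n::nat. \<exists>p\<in>P. \<exists>r\<in>carrier R. y [^] n = p \<oplus> r \<otimes> a"
    if a: "a \<in> carrier R" "a \<notin> P" for a
  proof -
    let ?J = "P <+>\<^bsub>R\<^esub> PIdl a"
    have J: "ideal ?J R" using a by (simp add: add_ideals P(1) cgenideal_ideal)
    have J_iff: "z \<in> ?J \<longleftrightarrow> (\<exists>p\<in>P. \<exists>r\<in>carrier R. z = p \<oplus> r \<otimes> a)" for z
      unfolding set_add_def' cgenideal_def by blast
    have "p \<in> ?J" if "p \<in> P" for p
    proof -
      have "p = p \<oplus> \<zero> \<otimes> a" using that a P.Icarr by simp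
      with that show ?thesis unfolding J_iff by blast
    qed
    then have "P \<subseteq> ?J" by blast
    moreover have "a \<in> ?J"
    proof -
      have "a = \<zero> \<oplus> \<one> \<otimes> a" using a by simp
      then show ?thesis unfolding J_iff using P.zero_closed by blast
    qed
    ultimately have "?J \<inter> ?S \<noteq> {}" using max J a(2) by blast
    then obtain n :: nat where "y [^] n \<in> ?J" by blast
    then show ?thesis unfolding J_iff by blast
  qed
  have "primeideal P R"
  proof (rule primeidealI)
    show "ideal P R" "cring R" by (rule P(1), rule is_cring)
    show "carrier R \<noteq> P" using y y_notin by blast
    fix a b assume ab: "a \<in> carrier R" "b \<in> carrier R" "a \<otimes> b \<in> P"
    show "a \<in> P \<or> b \<in> P"
    proof (rule ccontr)
      assume "\<not> (a \<in> P \<or> b \<in> P)"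
      then have "a \<notin> P" "b \<notin> P" by blast+
      obtain n :: nat and p r where p: "p \<in> P" "r \<in> carrier R" "y [^] n = p \<oplus> r \<otimes> a"
        using meets[OF ab(1) \<open>a \<notin> P\<close>] by blast
      obtain k :: nat and q s where q: "q \<in> P" "s \<in> carrier R" "y [^] k = q \<oplus> s \<otimes> b"
        using meets[OF ab(2) \<open>b \<notin> P\<close>] by blast
      note * = p q
      have c: "p \<in> carrier R" "q \<in> carrier R" using * P.Icarr by auto
      \<comment> \<open>Multiplying the two powers gives another power; each term of the expansion
        has a factor \<open>p\<close>, \<open>q\<close> or \<open>a \<otimes> b\<close> in
        \<open>P\<close>.\<close>
      have "y [^] (n + k) = (p \<oplus> r \<otimes> a) \<otimes> (q \<oplus> s \<otimes> b)"
        using * y by (simp flip: nat_pow_mult)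
      also have "\<dots> = p \<otimes> (q \<oplus> s \<otimes> b) \<oplus> ((r \<otimes> a) \<otimes> q \<oplus> (r \<otimes> s) \<otimes> (a \<otimes> b))"
        using * ab c by algebra
      also have "\<dots> \<in> P"
        using P.I_r_closed[OF *(1), of "q \<oplus> s \<otimes> b"] P.I_l_closed[OF *(4), of "r \<otimes> a"]
          P.I_l_closed[OF ab(3), of "r \<otimes> s"] * ab(1,2) c by simp
      finally show False using notin by blast
    qed
  qed
  with y_notin show ?thesis by blast
qed

section \<open>Jacobson radical, nilradical and non-zero-divisors\<close>

text \<open>Otherwise the principal ideal of \<open>\<one> \<oplus> y\<close> is proper and lies in
  a maximal ideal; that ideal also contains \<open>y\<close>, hence \<open>\<one>\<close>.\<close>

lemma (in cring) one_plus_jacobson_radical_unit: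
  assumes y: "y \<in> jacobson_radical R"
  shows "\<exists>z\<in>carrier R. (\<one> \<oplus> y) \<otimes> z = \<one>"
proof (rule ccontr)
  assume no: "\<not> ?thesis"
  have yc: "y \<in> carrier R" using y by (simp add: jacobson_radical_def)
  have "\<one> \<notin> PIdl (\<one> \<oplus> y)"
    using no yc m_comm[of "\<one> \<oplus> y"] by (force simp: cgenideal_def)
  then obtain P where P: "maximalideal P R" "PIdl (\<one> \<oplus> y) \<subseteq> P"
    using proper_ideal_in_maximalideal[OF cgenideal_ideal[of "\<one> \<oplus> y"]] yc by blast
  interpret maximalideal P R by fact
  have "\<one> \<oplus> y \<in> P" using P(2) cgenideal_self yc by blast
  moreover have "y \<in> P" using y P(1) by (auto simp: jacobson_radical_def)
  ultimately have "(\<one> \<oplus> y) \<oplus> \<ominus> y \<in> P" by (rule a_closed[OF _ a_inv_closed])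
  moreover have "(\<one> \<oplus> y) \<oplus> \<ominus> y = \<one>" using yc by algebra
  ultimately have "\<one> \<in> P" by (simp only:)
  then show False using one_imp_carrier I_notcarr by blast
qed

lemma (in cring) jacobson_radical_mult:
  assumes "x \<in> jacobson_radical R" "r \<in> carrier R"
  shows "x \<otimes> r \<in> jacobson_radical R"
proof -
  have "x \<otimes> r \<in> J" if "maximalideal J R" for J
  proof -
    interpret maximalideal J R by fact
    have "x \<in> J" using assms(1) that by (auto simp: jacobson_radical_def)
    then show ?thesis using assms(2) by (rule I_r_closed)
  qed
  then show ?thesis using assms by (simp add: jacobson_radical_def)
qed

lemma (in cring) primeideal_pow_mem:
  assumes P: "primeideal P R" and "x \<in> carrier R" "x [^] (n::nat) \<in> P"
  shows "x \<in> P"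
proof -
  interpret P: primeideal P R by fact
  show ?thesis using assms(3)
  proof (induction n)
    case 0
    then show ?case using P.one_imp_carrier P.I_notcarr by simp
  next
    case (Suc n)
    then show ?case using P.I_prime[of "x [^] n" x] assms(2) by auto
  qed
qed

lemma (in cring) nilradical_subset_jacobson_radical: "nilradical R \<subseteq> jacobson_radical R"
proof
  fix x assume x: "x \<in> nilradical R"
  then obtain n :: nat where n: "x \<in> carrier R" "x [^] n = \<zero>" by (auto simp: nilradical_def)
  have "x \<in> P" if "maximalideal P R" for P
  proof -
    have "primeideal P R" using that by (rule maximalideal_prime)
    moreover from this have "\<zero> \<in> P"
      by (auto simp: primeideal_def ideal_def intro: additive_subgroup.zero_closed)
    ultimately show ?thesis using n primeideal_pow_mem[of P x n] by simp
  qed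
  with n show "x \<in> jacobson_radical R" by (auto simp: jacobson_radical_def)
qed

lemma (in cring) non_zero_divisor_pow:
  assumes t: "non_zero_divisor R t"
  shows "non_zero_divisor R (t [^] (n::nat))"
proof (induction n)
  case 0
  then show ?case by (simp add: non_zero_divisor_def)
next
  case (Suc n)
  have tc: "t \<in> carrier R" using t by (simp add: non_zero_divisor_def)
  show ?case
    unfolding non_zero_divisor_def
  proof (intro conjI ballI impI)
    show "t [^] Suc n \<in> carrier R" using tc by simp
    fix y assume y: "y \<in> carrier R" "t [^] Suc n \<otimes> y = \<zero>"
    then have "t [^] n \<otimes> (t \<otimes> y) = \<zero>" using tc by (simp add: m_assoc)
    then have "t \<otimes> y = \<zero>" using Suc y(1) tc by (simp add: non_zero_divisor_def)
    then show "y = \<zero>" using t y(1) by (simp add: non_zero_divisor_def)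
  qed
qed

section \<open>Homogeneous components\<close>

context graded_ring
begin

text \<open>The description is meaningful for \<open>x\<close> in the carrier, where
  \<open>direct_sum\<close> gives existence and uniqueness.\<close>

definition component :: "'a \<Rightarrow> 'm \<Rightarrow> 'a"
  where "component x = (THE f. (\<forall>m. f m \<in> A m) \<and> finite {m. f m \<noteq> \<zero>} \<and>
    x = (\<Oplus>m\<in>{m. f m \<noteq> \<zero>}. f m))"

lemma zero_in_A [simp]: "\<zero> \<in> A m"
  using additive_subgroup.zero_closed[OF component_subgroup] .

lemma A_carrier: "a \<in> A m \<Longrightarrow> a \<in> carrier R"
  using additive_subgroup.a_Hcarr[OF component_subgroup] .

lemma
  assumes "x \<in> carrier R"
  shows component_in_A: "component x m \<in> A m"
    and finite_support: "finite {m. component x m \<noteq> \<zero>}"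
    and finsum_component: "(\<Oplus>m\<in>{m. component x m \<noteq> \<zero>}. component x m) = x"
  using theI'[OF direct_sum[OF assms]] unfolding component_def[symmetric] by auto

lemma component_carrier [simp]: "x \<in> carrier R \<Longrightarrow> component x m \<in> carrier R"
  using component_in_A A_carrier by blast

lemma finsum_component_superset:
  assumes "x \<in> carrier R" "finite F" "{m. component x m \<noteq> \<zero>} \<subseteq> F"
  shows "(\<Oplus>m\<in>F. component x m) = x"
proof -
  have "(\<Oplus>m\<in>F. component x m) = (\<Oplus>m\<in>{m. component x m \<noteq> \<zero>}. component x m)"
    by (rule add.finprod_mono_neutral_cong_right) (use assms in auto)
  with finsum_component assms show ?thesis by simp
qed

text \<open>Uniqueness in a convenient form: components can be read off any finite homogeneous
  decomposition, over an index set \<open>F\<close> that may be larger than the support.\<close>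

lemma component_eqI:
  assumes f: "\<And>m. f m \<in> A m" and F: "finite F" "{m. f m \<noteq> \<zero>} \<subseteq> F" and x: "x = (\<Oplus>m\<in>F. f m)"
  shows "component x = f"
proof -
  have c: "f m \<in> carrier R" for m using f A_carrier by blast
  have "x = (\<Oplus>m\<in>{m. f m \<noteq> \<zero>}. f m)"
    unfolding x by (rule add.finprod_mono_neutral_cong_right) (use F c in auto)
  moreover have "x \<in> carrier R" unfolding x using c by (simp add: finsum_closed)
  ultimately show ?thesis
    unfolding component_def using f F
    by (intro the1_equality direct_sum) (auto intro: finite_subset)
qed

lemma component_homogeneous:
  assumes "a \<in> A k"
  shows "component a m = (if m = k then a else \<zero>)"
proof -
  have "component a = (\<lambda>m. if m = k then a else \<zero>)"
    by (rule component_eqI[of _ "{k}"]) (use assms A_carrier in \<open>auto split: if_splits\<close>)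
  then show ?thesis by simp
qed

lemma component_add:
  assumes "x \<in> carrier R" "y \<in> carrier R"
  shows "component (x \<oplus> y) m = component x m \<oplus> component y m"
proof -
  let ?F = "{m. component x m \<noteq> \<zero>} \<union> {m. component y m \<noteq> \<zero>}"
  have "component (x \<oplus> y) = (\<lambda>m. component x m \<oplus> component y m)"
  proof (rule component_eqI[of _ ?F])
    show "component x m \<oplus> component y m \<in> A m" for m
      using assms component_in_A additive_subgroup.a_closed[OF component_subgroup] by blast
    show fin: "finite ?F" using assms finite_support by blast
    show "{m. component x m \<oplus> component y m \<noteq> \<zero>} \<subseteq> ?F" by auto
    have "(\<Oplus>m\<in>?F. component x m) = x" "(\<Oplus>m\<in>?F. component y m) = y"
      using assms fin by (auto intro!: finsum_component_superset)
    moreover have "(\<Oplus>m\<in>?F. component x m \<oplus> component y m)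
        = (\<Oplus>m\<in>?F. component x m) \<oplus> (\<Oplus>m\<in>?F. component y m)"
      using assms by (intro finsum_addf) auto
    ultimately show "x \<oplus> y = (\<Oplus>m\<in>?F. component x m \<oplus> component y m)" by simp
  qed
  then show ?thesis by simp
qed

lemma component_finsum:
  assumes "finite I" "\<And>i. i \<in> I \<Longrightarrow> g i \<in> carrier R"
  shows "component (\<Oplus>i\<in>I. g i) m = (\<Oplus>i\<in>I. component (g i) m)"
  using assms
proof (induction I rule: finite_induct)
  case empty
  \<comment> \<open>The zero element lies in every \<open>A k\<close>, so the degree can be taken to
    be \<open>m\<close> itself.\<close>
  show ?case using component_homogeneous[of \<zero> m m] by simp
next
  case (insert i I)
  then show ?case
    by (simp add: component_add finsum_closed Pi_def)
qed

text \<open>Only one factor is expanded here, and the other one in the companion lemma, so that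
  later arguments can split one factor at a time instead of handling a double sum.\<close>

lemma component_mult_left:
  assumes "x \<in> carrier R" "y \<in> carrier R"
  shows "component (x \<otimes> y) k =
    (\<Oplus>i\<in>{i. component x i \<noteq> \<zero>}. component (component x i \<otimes> y) k)"
proof -
  have "x \<otimes> y = (\<Oplus>i\<in>{i. component x i \<noteq> \<zero>}. component x i) \<otimes> y"
    using assms finsum_component by simp
  also have "\<dots> = (\<Oplus>i\<in>{i. component x i \<noteq> \<zero>}. component x i \<otimes> y)"
    using assms finite_support by (intro finsum_ldistr) auto
  finally show ?thesis
    using assms finite_support by (simp add: component_finsum)
qed

lemma component_mult_right:
  assumes "x \<in> carrier R" "y \<in> carrier R"
  shows "component (x \<otimes> y) k =
    (\<Oplus>j\<in>{j. component y j \<noteq> \<zero>}. component (x \<otimes> component y j) k)"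
proof -
  have "x \<otimes> y = x \<otimes> (\<Oplus>j\<in>{j. component y j \<noteq> \<zero>}. component y j)"
    using assms finsum_component by simp
  also have "\<dots> = (\<Oplus>j\<in>{j. component y j \<noteq> \<zero>}. x \<otimes> component y j)"
    using assms finite_support by (intro finsum_rdistr) auto
  finally show ?thesis
    using assms finite_support by (simp add: component_finsum)
qed

text \<open>The element is the sum of its components. For an ideal that is not graded, the converse
  can fail.\<close>

lemma mem_if_components_mem:
  assumes "ideal P R" "x \<in> carrier R" "\<And>m. component x m \<in> P"
  shows "x \<in> P"
  using additive_subgroup.finsum_mem[OF ideal.axioms(1)[OF assms(1)] abelian_group_axioms
      finite_support[OF assms(2)], of "component x"] assms finsum_component by simp

end

section \<open>Units in gradings by totally ordered cancellative monoids\<close>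

text \<open>The sort of \<open>'m\<close> encodes the ordered monoid: a total order, weakly monotone
  addition and cancellation.\<close>

locale ordered_graded_cring = graded_ring R A + cring R
  for R (structure)
    and A :: "'m::{linorder, ordered_comm_monoid_add, cancel_semigroup_add} \<Rightarrow> 'a set"
begin

text \<open>Cancellation upgrades weak monotonicity to strict monotonicity by excluding
  equality.\<close>

lemma degree_add_less_le_mono:
  fixes a b c d :: 'm
  assumes "a < b" "c \<le> d"
  shows "a + c < b + d"
proof -
  have "a + c \<le> b + c" using assms(1) by (simp add: add_right_mono)
  moreover have "a + c \<noteq> b + c" using assms(1) by auto
  ultimately show ?thesis using add_left_mono[OF assms(2), of b] by order
qed

text \<open>By cancellation, \<open>m + j = m + n\<close> forces \<open>j = n\<close>, so a single
  component of \<open>y\<close> contributes.\<close>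

lemma component_homogeneous_mult:
  assumes a: "a \<in> A m" and y: "y \<in> carrier R"
  shows "component (a \<otimes> y) (m + n) = a \<otimes> component y n"
proof -
  have ac: "a \<in> carrier R" using a A_carrier by blast
  have "component (a \<otimes> component y j) (m + n) = (if n = j then a \<otimes> component y j else \<zero>)" for j
    using component_homogeneous[OF component_mult[OF a component_in_A[OF y]], of j "m + n"] by simp
  then have "component (a \<otimes> y) (m + n) =
      (\<Oplus>j\<in>{j. component y j \<noteq> \<zero>}. if n = j then a \<otimes> component y j else \<zero>)"
    using component_mult_right[OF ac y] by simp
  also have "\<dots> = a \<otimes> component y n"
  proof (cases "component y n = \<zero>")
    case True
    then have "(\<Oplus>j\<in>{j. component y j \<noteq> \<zero>}. if n = j then a \<otimes> component y j else \<zero>) = \<zero>"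
      by (intro add.finprod_one_eqI) auto
    with True ac show ?thesis by simp
  next
    case False
    then show ?thesis using ac y finite_support[OF y]
      by (intro finsum_singleton) auto
  qed
  finally show ?thesis .
qed

text \<open>The degree-zero component of \<open>\<one>\<close> fixes every homogeneous
  \<open>a\<close>: compare degrees in \<open>a \<otimes> \<one> = a\<close>. Summing over the
  components of \<open>\<one>\<close>, it equals \<open>\<one>\<close>.\<close>

lemma one_in_A_zero: "\<one> \<in> A 0"
proof -
  let ?e = "component \<one> 0"
  have e: "?e \<in> carrier R" by simp
  have hom: "a \<otimes> ?e = a" if "a \<in> A m" for a m
    using component_homogeneous_mult[OF that one_closed, of 0] component_homogeneous[OF that, of m]
      A_carrier[OF that] by simp
  have "?e = \<one> \<otimes> ?e" by simp
  also have "\<dots> = (\<Oplus>m\<in>{m. component \<one> m \<noteq> \<zero>}. component \<one> m) \<otimes> ?e"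
    by (simp only: finsum_component[OF one_closed])
  also have "\<dots> = (\<Oplus>m\<in>{m. component \<one> m \<noteq> \<zero>}. component \<one> m \<otimes> ?e)"
    by (intro finsum_ldistr finite_support) auto
  also have "\<dots> = (\<Oplus>m\<in>{m. component \<one> m \<noteq> \<zero>}. component \<one> m)"
    using hom[OF component_in_A[OF one_closed]] by simp
  also have "\<dots> = \<one>" by (simp add: finsum_component)
  finally show ?thesis using component_in_A[OF one_closed, of 0] by simp
qed

text \<open>Modulo \<open>P\<close>, the pair \<open>(m, n)\<close> is the only one contributing to
  degree \<open>m + n\<close>, and its product survives because \<open>P\<close> is prime. The
  condition \<open>extreme\<close> is phrased without the order so as to cover both the largest and
  the smallest degrees.\<close>

lemma component_extreme_notin:
  assumes P: "primeideal P R" and x: "x \<in> carrier R" and y: "y \<in> carrier R"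
    and m: "component x m \<notin> P" and n: "component y n \<notin> P"
    and extreme: "\<And>i j. i + j = m + n \<Longrightarrow> component x i \<notin> P \<Longrightarrow> component y j \<notin> P \<Longrightarrow> i = m"
  shows "component (x \<otimes> y) (m + n) \<notin> P"
proof
  assume mem: "component (x \<otimes> y) (m + n) \<in> P"
  interpret P: primeideal P R by fact
  let ?S = "{i. component x i \<noteq> \<zero>}"
  \<comment> \<open>If the degrees add up to \<open>m + n\<close>, then \<open>extreme\<close> puts
    one factor in \<open>P\<close>; otherwise this component is zero.\<close>
  have off: "component (component x i \<otimes> component y j) (m + n) \<in> P" if "i \<noteq> m" for i j
  proof (cases "i + j = m + n")
    case True
    with extreme[OF True] that have "component x i \<otimes> component y j \<in> P"
      using P.I_l_closed P.I_r_closed x y by (meson component_carrier)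
    then show ?thesis
      using component_homogeneous[OF component_mult[OF component_in_A[OF x] component_in_A[OF y]]]
      by simp
  next
    case False
    then show ?thesis
      using component_homogeneous[OF component_mult[OF component_in_A[OF x] component_in_A[OF y]]]
      by simp
  qed
  have rest: "component (component x i \<otimes> y) (m + n) \<in> P" if "i \<noteq> m" for i
    unfolding component_mult_right[OF component_carrier[OF x] y]
    by (intro P.finsum_mem abelian_group_axioms finite_support y off that)
  let ?r = "\<Oplus>i\<in>?S - {m}. component (component x i \<otimes> y) (m + n)"
  have r: "?r \<in> P"
    using finite_support[OF x] by (intro P.finsum_mem abelian_group_axioms rest) auto
  have fin: "finite (?S - {m})" using finite_support[OF x] by simp
  have S: "insert m (?S - {m}) = ?S" using m by auto
  have "component (x \<otimes> y) (m + n) =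
      (\<Oplus>i\<in>insert m (?S - {m}). component (component x i \<otimes> y) (m + n))"
    unfolding S by (rule component_mult_left[OF x y])
  also have "\<dots> = component (component x m \<otimes> y) (m + n) \<oplus> ?r"
    by (rule finsum_insert[OF fin]) (use x y in auto)
  also have "component (component x m \<otimes> y) (m + n) = component x m \<otimes> component y n"
    by (rule component_homogeneous_mult[OF component_in_A[OF x] y])
  finally have eq: "component (x \<otimes> y) (m + n) = component x m \<otimes> component y n \<oplus> ?r" .
  \<comment> \<open>Subtracting the remainder would put the product of two elements outside
    \<open>P\<close> into \<open>P\<close>.\<close>
  have "component x m \<otimes> component y n = (component x m \<otimes> component y n \<oplus> ?r) \<oplus> \<ominus> ?r"
    using x y P.Icarr[OF r] by (simp add: a_assoc r_neg)
  also have "\<dots> \<in> P" using mem r eq by (metis P.a_closed P.a_inv_closed)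
  finally show False using P.I_prime m n x y by (meson component_carrier)
qed

text \<open>Consider the degrees at which \<open>x\<close> and its inverse \<open>y\<close> have
  components outside \<open>P\<close>. The two largest, and likewise the two smallest, add up to a
  degree where \<open>\<one>\<close> has a component outside \<open>P\<close>, that is, to
  \<open>0\<close>. Strict monotonicity then leaves a single degree for \<open>x\<close>.\<close>

lemma unit_component_mem_primeideal:
  assumes P: "primeideal P R" and x: "x \<in> carrier R" and y: "y \<in> carrier R"
    and xy: "x \<otimes> y = \<one>"
    and ij: "component x i \<notin> P" "component x j \<notin> P"
  shows "i = j"
proof -
  interpret P: primeideal P R by fact
  have one: "\<one> \<notin> P" using P.one_imp_carrier P.I_notcarr by blast
  define X where "X = {i. component x i \<notin> P}"
  define Y where "Y = {i. component y i \<notin> P}"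
  have X: "finite X" "X \<noteq> {}"
    unfolding X_def using ij by (auto intro: finite_subset[OF _ finite_support[OF x]])
  \<comment> \<open>Otherwise \<open>\<one> = x \<otimes> y\<close> would lie in \<open>P\<close>;
    so some component of \<open>y\<close> is outside \<open>P\<close>.\<close>
  have "y \<notin> P" using P.I_l_closed x xy one by metis
  then have Y: "finite Y" "Y \<noteq> {}"
    unfolding Y_def using mem_if_components_mem[OF P.is_ideal y]
    by (auto intro: finite_subset[OF _ finite_support[OF y]])
  have degree_zero: "m + n = 0" if "component (x \<otimes> y) (m + n) \<notin> P" for m n
    using that component_homogeneous[OF one_in_A_zero, of "m + n"] xy by (auto split: if_splits)
  have "Max X + Max Y = 0"
  proof (intro degree_zero component_extreme_notin P x y)
    show "component x (Max X) \<notin> P" "component y (Max Y) \<notin> P"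
      using Max_in[OF X] Max_in[OF Y] by (auto simp: X_def Y_def)
    fix k l assume "k + l = Max X + Max Y" "component x k \<notin> P" "component y l \<notin> P"
    \<comment> \<open>If \<open>k\<close> were smaller than \<open>Max X\<close>, then with
      \<open>l \<le> Max Y\<close> the sum of degrees would be strictly too small.\<close>
    then show "k = Max X"
      using Max_ge[OF X(1), of k] Max_ge[OF Y(1), of l] degree_add_less_le_mono[of k "Max X" l "Max Y"]
      by (force simp: X_def Y_def)
  qed
  moreover have "Min X + Min Y = 0"
  proof (intro degree_zero component_extreme_notin P x y)
    show "component x (Min X) \<notin> P" "component y (Min Y) \<notin> P"
      using Min_in[OF X] Min_in[OF Y] by (auto simp: X_def Y_def)
    fix k l assume "k + l = Min X + Min Y" "component x k \<notin> P" "component y l \<notin> P"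
    then show "k = Min X"
      using Min_le[OF X(1), of k] Min_le[OF Y(1), of l] degree_add_less_le_mono[of "Min X" k "Min Y" l]
      by (force simp: X_def Y_def)
  qed
  \<comment> \<open>Together with \<open>Min Y \<le> Max Y\<close>, a strict inequality would give
    \<open>0 < 0\<close>.\<close>
  ultimately have "\<not> Min X < Max X"
    using degree_add_less_le_mono[of "Min X" "Max X" "Min Y" "Max Y"]
      Min_le[OF Y(1) Max_in[OF Y]] by force
  moreover have "Min X \<le> i" "i \<le> Max X" "Min X \<le> j" "j \<le> Max X"
    using X(1) ij by (simp_all add: X_def)
  ultimately show ?thesis by order
qed

text \<open>The unit \<open>\<one> \<oplus> y\<close> has degree-zero component
  \<open>\<one>\<close>, which is outside \<open>P\<close>. By the previous lemma all its other
  components, which are those of \<open>y\<close>, lie in \<open>P\<close>.\<close>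

lemma mem_primeideal_if_one_plus_unit:
  assumes P: "primeideal P R" and y: "y \<in> carrier R" "component y 0 = \<zero>"
    and z: "z \<in> carrier R" "(\<one> \<oplus> y) \<otimes> z = \<one>"
  shows "y \<in> P"
proof -
  interpret P: primeideal P R by fact
  have one: "\<one> \<notin> P" using P.one_imp_carrier P.I_notcarr by blast
  have comp: "component (\<one> \<oplus> y) m = (if m = 0 then \<one> else component y m)" for m
    using component_add[OF one_closed y(1)] component_homogeneous[OF one_in_A_zero] y by simp
  have "component y m \<in> P" for m
  proof (cases "m = 0")
    case True
    then show ?thesis using y by simp
  next
    case False
    then show ?thesis
      using unit_component_mem_primeideal[OF P _ z(1) z(2), of 0 m] comp one y(1) by auto
  qed
  then show ?thesis by (rule mem_if_components_mem[OF P.is_ideal y(1)])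
qed

section \<open>Shifting degrees by powers of a homogeneous non-zero-divisor\<close>

text \<open>The iterate \<open>((+) d ^^ k) 0\<close> is the multiple \<open>k d\<close>. These
  multiples strictly increase if \<open>d\<close> is positive and strictly decrease if it is
  negative.\<close>

lemma multiples_inj:
  fixes d :: 'm
  assumes "d \<noteq> 0"
  shows "inj (\<lambda>k. ((+) d ^^ k) 0)"
proof (cases "0 < d")
  case True
  have "((+) d ^^ k) 0 < ((+) d ^^ Suc k) 0" for k
    using degree_add_less_le_mono[OF True order.refl, of "((+) d ^^ k) 0"] by simp
  then have "strict_mono (\<lambda>k. ((+) d ^^ k) 0)"
    unfolding strict_mono_Suc_iff by blast
  then show ?thesis by (rule strict_mono_imp_inj_on)
next
  case False
  then have d: "d < 0" using assms by simp
  have step: "((+) d ^^ Suc k) 0 < ((+) d ^^ k) 0" for k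
    using degree_add_less_le_mono[OF d order.refl, of "((+) d ^^ k) 0"] by simp
  have "((+) d ^^ l) 0 < ((+) d ^^ k) 0" if "k < l" for k l
    using that by (induction rule: less_Suc_induct) (rule step, order)
  then show ?thesis by (intro linorder_injI) (metis less_irrefl)
qed

lemma pow_in_A:
  assumes "t \<in> A d"
  shows "t [^] (k::nat) \<in> A (((+) d ^^ k) 0)"
proof (induction k)
  case 0
  then show ?case by (simp add: one_in_A_zero)
next
  case (Suc k)
  then show ?case using component_mult[OF Suc assms] by (simp add: add.commute)
qed

text \<open>Each degree \<open>m\<close> in the support of \<open>x\<close> is sent to
  \<open>0\<close> by at most one multiple of \<open>d\<close>. The support is finite, so only
  finitely many exponents are bad.\<close>

lemma exists_pow_component_zero:
  assumes t: "t \<in> A d" and d: "d \<noteq> 0" and x: "x \<in> carrier R"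
  shows "\<exists>k::nat. component (x \<otimes> t [^] k) 0 = \<zero>"
proof -
  let ?S = "{m. component x m \<noteq> \<zero>}" and ?s = "\<lambda>k. ((+) d ^^ k) 0"
  have tc: "t \<in> carrier R" using t A_carrier by blast
  have unique: "k = l" if "m + ?s k = 0" "m + ?s l = 0" for m k l
  proof -
    have "m + ?s k = m + ?s l" using that by (simp only:)
    then have "?s k = ?s l" by (simp only: add_left_cancel)
    then show ?thesis using injD[OF multiples_inj[OF d]] by blast
  qed
  have "finite {k. m + ?s k = 0}" for m
  proof (cases "\<exists>k. m + ?s k = 0")
    case True
    then obtain k where "m + ?s k = 0" ..
    with unique have "{k. m + ?s k = 0} \<subseteq> {k}" by blast
    then show ?thesis by (rule finite_subset) simp
  next
    case False
    then show ?thesis by simp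
  qed
  then have "finite (\<Union>m\<in>?S. {k. m + ?s k = 0})" using finite_support[OF x] by blast
  \<comment> \<open>Any exponent outside the finite set of bad ones will do.\<close>
  then obtain k where k: "\<And>m. m \<in> ?S \<Longrightarrow> m + ?s k \<noteq> 0"
    using ex_new_if_finite[OF infinite_UNIV_nat] by blast
  have "component (component x m \<otimes> t [^] k) 0 = \<zero>" if "m \<in> ?S" for m
    using component_homogeneous[OF component_mult[OF component_in_A[OF x] pow_in_A[OF t]], of m k 0]
      k[OF that] by auto
  then have "component (x \<otimes> t [^] k) 0 = \<zero>"
    unfolding component_mult_left[OF x nat_pow_closed[OF tc]] by (rule add.finprod_one_eqI)
  then show ?thesis by blast
qed

lemma jacobson_radical_subset_nilradical:
  assumes t: "t \<in> A d" "d \<noteq> 0" "non_zero_divisor R t"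
  shows "jacobson_radical R \<subseteq> nilradical R"
proof
  fix x assume x: "x \<in> jacobson_radical R"
  then have xc: "x \<in> carrier R" by (simp add: jacobson_radical_def)
  have tc: "t \<in> carrier R" using t A_carrier by blast
  obtain k :: nat where k: "component (x \<otimes> t [^] k) 0 = \<zero>"
    using exists_pow_component_zero[OF t(1,2) xc] by blast
  let ?y = "x \<otimes> t [^] k"
  have yc: "?y \<in> carrier R" using xc tc by simp
  obtain z where z: "z \<in> carrier R" "(\<one> \<oplus> ?y) \<otimes> z = \<one>"
    using one_plus_jacobson_radical_unit[OF jacobson_radical_mult[OF x, of "t [^] k"]] tc by auto
  then have "?y \<in> P" if "primeideal P R" for P
    using mem_primeideal_if_one_plus_unit[OF that yc k] by blast
  then obtain n :: nat where n: "?y [^] n = \<zero>"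
    using exists_primeideal_avoiding[OF yc] by blast
  \<comment> \<open>Regrouping isolates a power of \<open>t\<close>, itself a non-zero-divisor,
    which can be cancelled from \<open>?y [^] n = \<zero>\<close>.\<close>
  have "t [^] (k * n) \<otimes> x [^] n = ?y [^] n"
    using xc tc by (simp add: nat_pow_distrib nat_pow_pow m_comm)
  with n have "x [^] n = \<zero>"
    using non_zero_divisor_pow[OF t(3), of "k * n"] xc by (simp add: non_zero_divisor_def)
  with xc show "x \<in> nilradical R" by (auto simp: nilradical_def)
qed

end

theorem corollary7p18:
  fixes R :: "('a, 'b) ring_scheme"
    and A :: "'m::{linorder, ordered_comm_monoid_add, cancel_semigroup_add} \<Rightarrow> 'a set"
  assumes "cring R"
    and "graded_ring R A"
    and "\<exists>m x. m \<noteq> 0 \<and> homogeneous_of_degree R A m x \<and> non_zero_divisor R x"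
  shows "quasi_jacobson R"
proof -
  interpret ordered_graded_cring R A
    using assms(1,2) by (rule ordered_graded_cring.intro[rotated])
  show ?thesis
    using assms(3) jacobson_radical_subset_nilradical nilradical_subset_jacobson_radical
    unfolding quasi_jacobson_def homogeneous_of_degree_def by blast
qed

end
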